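(* There exist constants $k, K > 0$ such that for all integers $r \ge 2$ and all real $\delta \in (0,1)$, \[ k\, r \left\lceil \frac{r}{\log(1/\delta)} \right\rceil \;\le\; tc_r(\delta) \;\le\; K\, r \left\lceil \frac{r}{\log(1/\delta)} \cdot \log\left(1 + \frac{r}{\log(1/\delta)}\right) \right\rceil, \] and if in addition $\delta \ge 1/2$, then $tc_r(\delta) \le \dfrac{K r^2}{\log(1/\delta)}$.
   Context: An $r$-edge-coloured graph is a finite simple graph $G$ with a map $\chi:E(G)\to[r]$; $\delta(G)$ is the minimum degree of the underlying uncoloured graph. For $c\in[r]$, $G_c$ is the spanning subgraph of edges of colour $c$; a monochromatic component of $G$ is a connected component (possibly a single vertex) of some $G_c$, so every vertex lies in a monochromatic component of each colour. A monochromatic tree is a tree subgraph all of whose edges have the same colour (a single vertex is allowed). For an $r$-edge-coloured graph $G$, $tc(G)$ is the minimum number of monochromatic trees (not necessarily vertex-disjoint) whose vertex sets together cover $V(G)$. Let $\mathcal G(n,r,\delta)$ be the family of $n$-vertex $r$-edge-coloured graphs $G$ with $\delta(G)\ge(1-\delta)n$ and $tc_r(\delta):=\limsup_{n\to\infty}\max_{G\in\mathcal G(n,r,\delta)} tc(G)$. Logarithms are natural. *)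

theory Defs
  imports Complex_Main "HOL-Library.Extended_Real"
begin

record 'a col_graph =
  verts :: "'a set"
  edges :: "'a set set"
  colour :: "'a set \<Rightarrow> nat"

definition simple_graph :: "'a set \<Rightarrow> 'a set set \<Rightarrow> bool" where
  "simple_graph V E \<longleftrightarrow> finite V \<and> (\<forall>e\<in>E. e \<subseteq> V \<and> card e = 2)"

text \<open>The colouring is a total function; only its values on edges are constrained, and only
  these are ever used.\<close>

definition edge_coloured :: "nat \<Rightarrow> 'a col_graph \<Rightarrow> bool" where
  "edge_coloured r G \<longleftrightarrow>
     simple_graph (verts G) (edges G) \<and> (\<forall>e\<in>edges G. colour G e \<in> {1..r})"

definition degree :: "'a col_graph \<Rightarrow> 'a \<Rightarrow> nat" where
  "degree G v = card {e \<in> edges G. v \<in> e}"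

definition min_degree :: "'a col_graph \<Rightarrow> nat" where
  "min_degree G = Min (degree G ` verts G)"

definition connected_graph :: "'a set \<Rightarrow> 'a set set \<Rightarrow> bool" where
  "connected_graph W F \<longleftrightarrow> W \<noteq> {} \<and> (\<forall>u\<in>W. \<forall>v\<in>W. (u, v) \<in> {(x, y). {x, y} \<in> F}\<^sup>*)"

definition is_cycle :: "'a set set \<Rightarrow> 'a list \<Rightarrow> bool" where
  "is_cycle F vs \<longleftrightarrow> length vs \<ge> 3 \<and> distinct vs \<and>
     (\<forall>i<length vs. {vs ! i, vs ! (Suc i mod length vs)} \<in> F)"

definition is_tree :: "'a set \<Rightarrow> 'a set set \<Rightarrow> bool" where
  "is_tree W F \<longleftrightarrow> simple_graph W F \<and> connected_graph W F \<and> (\<nexists>vs. is_cycle F vs)"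

definition mono_tree :: "'a col_graph \<Rightarrow> 'a set \<times> 'a set set \<Rightarrow> bool" where
  "mono_tree G T \<longleftrightarrow> fst T \<subseteq> verts G \<and> snd T \<subseteq> edges G \<and> is_tree (fst T) (snd T) \<and>
     (\<exists>c. \<forall>e\<in>snd T. colour G e = c)"

definition tc :: "'a col_graph \<Rightarrow> nat" where
  "tc G = (LEAST m. \<exists>\<T>. finite \<T> \<and> card \<T> = m \<and> (\<forall>T\<in>\<T>. mono_tree G T) \<and>
                      (\<Union>T\<in>\<T>. fst T) = verts G)"

text \<open>Vertices are natural numbers: every finite graph is isomorphic to such a graph.\<close>

definition graph_family :: "nat \<Rightarrow> nat \<Rightarrow> real \<Rightarrow> nat col_graph set" where
  "graph_family n r \<delta> = {G. edge_coloured r G \<and> card (verts G) = n \<and>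
                            real (min_degree G) \<ge> (1 - \<delta>) * real n}"

text \<open>The supremum is a maximum whenever the family is nonempty, because \<open>tc G \<le> n\<close>. For
  \<open>\<delta> > 0\<close> the family is nonempty for all large \<open>n\<close>, so the value at the empty family and the
  unspecified minimum degree of the graph without vertices do not affect the limit superior.
  It is taken in the extended reals so that finiteness is not presupposed.\<close>

definition tc_lim :: "nat \<Rightarrow> real \<Rightarrow> ereal" where
  "tc_lim r \<delta> = limsup (\<lambda>n. SUP G\<in>graph_family n r \<delta>. ereal (real (tc G)))"

end

theory Submission
  imports Defs "HOL-Library.FuncSet"
begin

text \<open>
  Assign to every vertex the set of the \<open>r\<close> monochromatic components containing it. Adjacent
  vertices share a component, so these \<open>r\<close>-sets form a hypergraph in which every edge meets all but
  a fraction \<open>\<delta>\<close> of the edges, and \<open>tc\<close> is at most its cover number. If the hypergraph has no cover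
  of size \<open>s * r\<close>, a minimal subfamily with this property has at most about \<open>(e (s + 1))^r\<close> members
  by a set-pair inequality of Bollobas type, whereas \<open>s\<close> greedily chosen edges, with their \<open>s * r\<close>
  points, meet all but a fraction \<open>\<delta>^s\<close> of it. For \<open>s\<close> of order
  \<open>x ln (1 + x)\<close>, \<open>x = r / ln (1 / \<delta>)\<close>, this is a contradiction. For \<open>\<delta> \<ge> 1/2\<close> it is better to take
  all components of size at least \<open>(1 - \<delta>) n / r\<close>.

  For the lower bound let every vertex choose about \<open>3 r / 4\<close> of the colours and one of \<open>m\<close> values for
  each of them, and join two vertices if they agree somewhere. Any two vertices have at least
  \<open>r / 2\<close> chosen colours in common, so a vertex misses a fraction of at most about \<open>exp (- r / (2 m))\<close>
  of the others, while a cover must use up all \<open>m\<close> values of more than \<open>r / 4\<close> colours.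
\<close>

section \<open>Covers of almost intersecting hypergraphs\<close>

lemma sum_binomial_weights_Pow:
  fixes p q :: real
  assumes "finite Y" "p + q = 1"
  shows "(\<Sum>R\<in>Pow Y. p ^ card R * q ^ card (Y - R)) = 1"
proof -
  have "(\<Prod>i\<in>Y. p + q) = (\<Sum>R\<in>Pow Y. (\<Prod>i\<in>R. p) * (\<Prod>i\<in>Y - R. q))"
    by (rule prod_add) (rule assms)
  then show ?thesis using assms by simp
qed

text \<open>The sum is the probability that a random subset of \<open>X\<close> contains
  \<open>A\<close> and avoids \<open>B\<close>. Each point of \<open>A\<close> contributes
  \<open>p\<close>, each point of \<open>B\<close> contributes \<open>q\<close>, and the weights of
  the free points in \<open>X - A - B\<close> sum to 1.\<close>

lemma sum_binomial_weights_between: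
  fixes p q :: real
  assumes X: "finite X" and A: "A \<subseteq> X" and B: "B \<subseteq> X" and AB: "A \<inter> B = {}" and pq: "p + q = 1"
  shows "(\<Sum>R | A \<subseteq> R \<and> R \<subseteq> X - B. p ^ card R * q ^ card (X - R)) = p ^ card A * q ^ card B"
proof -
  define Y where "Y = X - A - B"
  have fin: "finite Y" "finite A" "finite B"
    using X finite_subset[OF A X] finite_subset[OF B X] by (simp_all add: Y_def)
  have bij: "bij_betw (\<lambda>R. A \<union> R) (Pow Y) {R. A \<subseteq> R \<and> R \<subseteq> X - B}"
    by (rule bij_betw_byWitness[where f' = "\<lambda>R. R - A"]) (use A AB in \<open>auto simp: Y_def\<close>)
  have "(\<Sum>R | A \<subseteq> R \<and> R \<subseteq> X - B. p ^ card R * q ^ card (X - R)) =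
        (\<Sum>R\<in>Pow Y. p ^ card (A \<union> R) * q ^ card (X - (A \<union> R)))"
    by (rule sum.reindex_bij_betw[OF bij, symmetric])
  also have "\<dots> = (\<Sum>R\<in>Pow Y. (p ^ card A * q ^ card B) * (p ^ card R * q ^ card (Y - R)))"
  proof (rule sum.cong[OF refl])
    fix R assume "R \<in> Pow Y"
    then have R: "R \<subseteq> Y" by simp
    have "card (A \<union> R) = card A + card R"
      using R fin finite_subset[OF R] by (intro card_Un_disjoint) (auto simp: Y_def)
    moreover have "X - (A \<union> R) = B \<union> (Y - R)"
      using R A B AB by (auto simp: Y_def)
    moreover have "card (B \<union> (Y - R)) = card B + card (Y - R)"
      using fin by (intro card_Un_disjoint) (auto simp: Y_def)
    ultimately show "p ^ card (A \<union> R) * q ^ card (X - (A \<union> R)) =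
        (p ^ card A * q ^ card B) * (p ^ card R * q ^ card (Y - R))"
      by (simp add: power_add)
  qed
  also have "\<dots> = p ^ card A * q ^ card B"
    by (simp add: sum_distrib_left[symmetric] sum_binomial_weights_Pow[OF fin(1) pq])
  finally show ?thesis .
qed

text \<open>Put every point into a random set \<open>R\<close> independently with probability \<open>p\<close>. The events
  \<open>A u \<subseteq> R \<and> B u \<inter> R = {}\<close> are pairwise disjoint.\<close>

lemma set_pair_inequality:
  fixes p q :: real
  assumes W: "finite W"
    and fin: "\<And>u. u \<in> W \<Longrightarrow> finite (A u)" "\<And>u. u \<in> W \<Longrightarrow> finite (B u)"
    and disj: "\<And>u. u \<in> W \<Longrightarrow> A u \<inter> B u = {}"
    and cross: "\<And>u v. u \<in> W \<Longrightarrow> v \<in> W \<Longrightarrow> u \<noteq> v \<Longrightarrow> A u \<inter> B v \<noteq> {}"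
    and pq: "0 \<le> p" "0 \<le> q" "p + q = 1"
  shows "(\<Sum>u\<in>W. p ^ card (A u) * q ^ card (B u)) \<le> 1"
proof -
  define X where "X = (\<Union>u\<in>W. A u \<union> B u)"
  define E where "E u = {R. A u \<subseteq> R \<and> R \<subseteq> X - B u}" for u
  have X: "finite X" using W fin unfolding X_def by auto
  have E: "E u \<subseteq> Pow X" for u unfolding E_def by auto
  then have finE: "finite (E u)" for u using X finite_subset by blast
  \<comment> \<open>A common member would contain \<open>A u\<close> and be disjoint from
    \<open>B v\<close>, but these two sets meet.\<close>
  have disjE: "E u \<inter> E v = {}" if "u \<in> W" "v \<in> W" "u \<noteq> v" for u v
    using cross[OF that] unfolding E_def by blast
  have "(\<Sum>u\<in>W. p ^ card (A u) * q ^ card (B u)) =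
        (\<Sum>u\<in>W. \<Sum>R\<in>E u. p ^ card R * q ^ card (X - R))"
    unfolding E_def
    by (intro sum.cong refl sum_binomial_weights_between[symmetric])
       (use X disj pq in \<open>auto simp: X_def\<close>)
  also have "\<dots> = (\<Sum>R\<in>(\<Union>u\<in>W. E u). p ^ card R * q ^ card (X - R))"
    using W finE disjE by (intro sum.UNION_disjoint[symmetric]) auto
  also have "\<dots> \<le> (\<Sum>R\<in>Pow X. p ^ card R * q ^ card (X - R))"
    using X E pq by (intro sum_mono2) auto
  also have "\<dots> = 1" by (rule sum_binomial_weights_Pow[OF X pq(3)])
  finally show ?thesis .
qed

section \<open>Greedy choices and the cover bound\<close>

text \<open>Double counting of the disjoint pairs in \<open>V \<times> U\<close> shows that an
  average \<open>v\<close> misses at most a fraction \<delta> of \<open>U\<close>. The hypothesis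
  counts within \<open>V\<close> while \<open>U\<close> is an arbitrary subset, so the choice can be
  repeated in a shrinking subfamily.\<close>

lemma ex_vertex_meeting_most:
  fixes A :: "'v \<Rightarrow> 'x set" and \<delta> :: real
  assumes V: "finite V" "V \<noteq> {}" and U: "U \<subseteq> V"
    and few: "\<And>w. w \<in> V \<Longrightarrow> real (card {v \<in> V. A v \<inter> A w = {}}) \<le> \<delta> * real (card V)"
  shows "\<exists>v\<in>V. real (card {w \<in> U. A v \<inter> A w = {}}) \<le> \<delta> * real (card U)"
proof (rule ccontr)
  assume "\<not> ?thesis"
  then have *: "\<And>v. v \<in> V \<Longrightarrow> \<delta> * real (card U) < real (card {w \<in> U. A v \<inter> A w = {}})" by auto
  have finU: "finite U" using U V finite_subset by blast
  have "(\<Sum>v\<in>V. card {w \<in> U. A v \<inter> A w = {}}) = (\<Sum>w\<in>U. card {v \<in> V. A v \<inter> A w = {}})"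
    by (rule sum_multicount_gen[symmetric]) (use V finU in auto)
  then have "(\<Sum>v\<in>V. real (card {w \<in> U. A v \<inter> A w = {}})) =
             (\<Sum>w\<in>U. real (card {v \<in> V. A v \<inter> A w = {}}))"
    by (simp flip: of_nat_sum)
  also have "\<dots> \<le> (\<Sum>w\<in>U. \<delta> * real (card V))"
    using few U by (intro sum_mono) auto
  also have "\<dots> = (\<Sum>v\<in>V. \<delta> * real (card U))" by simp
  also have "\<dots> < (\<Sum>v\<in>V. real (card {w \<in> U. A v \<inter> A w = {}}))"
    using V * by (intro sum_strict_mono) auto
  finally show False by simp
qed

text \<open>Each round applies the averaging argument to the members of \<open>W\<close> not met so
  far and leaves at most a fraction \<delta> of them. The chosen vertices come from \<open>V\<close>
  and need not lie in \<open>W\<close>.\<close>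

lemma ex_vertices_meeting_most:
  fixes A :: "'v \<Rightarrow> 'x set" and \<delta> :: real
  assumes V: "finite V" "V \<noteq> {}" and W: "W \<subseteq> V" and \<delta>: "0 \<le> \<delta>"
    and few: "\<And>w. w \<in> V \<Longrightarrow> real (card {v \<in> V. A v \<inter> A w = {}}) \<le> \<delta> * real (card V)"
  shows "\<exists>D\<subseteq>V. finite D \<and> card D \<le> s \<and>
           real (card {w \<in> W. \<forall>v\<in>D. A v \<inter> A w = {}}) \<le> \<delta> ^ s * real (card W)"
proof (induction s)
  case 0
  show ?case by (rule exI[of _ "{}"]) simp
next
  case (Suc s)
  then obtain D where D: "D \<subseteq> V" "finite D" "card D \<le> s"
    "real (card {w \<in> W. \<forall>v\<in>D. A v \<inter> A w = {}}) \<le> \<delta> ^ s * real (card W)" by blast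
  define U where "U = {w \<in> W. \<forall>v\<in>D. A v \<inter> A w = {}}"
  have "U \<subseteq> V" using W by (auto simp: U_def)
  from ex_vertex_meeting_most[OF V this few] obtain v where
    v: "v \<in> V" "real (card {w \<in> U. A v \<inter> A w = {}}) \<le> \<delta> * real (card U)" by blast
  have "{w \<in> U. A v \<inter> A w = {}} = {w \<in> W. \<forall>v\<in>insert v D. A v \<inter> A w = {}}"
    by (auto simp: U_def)
  moreover have "\<delta> * real (card U) \<le> \<delta> ^ Suc s * real (card W)"
    using mult_left_mono[OF D(4)[folded U_def] \<delta>] by (simp add: mult.assoc)
  ultimately have "real (card {w \<in> W. \<forall>v\<in>insert v D. A v \<inter> A w = {}}) \<le> \<delta> ^ Suc s * real (card W)"
    using v(2) by simp
  moreover have "card (insert v D) \<le> Suc s" using D card_insert_le_m1 by (simp add: card_insert_if)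
  ultimately show ?case using D v(1) by (intro exI[of _ "insert v D"]) auto
qed

text \<open>A minimal subfamily \<open>W\<close> without a cover is bounded in size by the set-pair
  inequality, since each member \<open>u\<close> comes with a cover \<open>B u\<close> of all the
  others. By the choice of \<open>s\<close>, this size is so small that \<open>s\<close> greedy
  edges leave less than one member of \<open>W\<close> unmet, and their union is a cover after
  all.\<close>

lemma almost_intersecting_cover:
  fixes A :: "'v \<Rightarrow> 'x set" and \<delta> p :: real
  assumes V: "finite V" and A: "\<And>v. v \<in> V \<Longrightarrow> finite (A v) \<and> card (A v) \<le> r" and \<delta>: "0 \<le> \<delta>"
    and few: "\<And>w. w \<in> V \<Longrightarrow> real (card {v \<in> V. A v \<inter> A w = {}}) \<le> \<delta> * real (card V)"
    and p: "0 < p" "p < 1" and s: "\<delta> ^ s < p ^ r * (1 - p) ^ (s * r)"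
  shows "\<exists>B. B \<subseteq> (\<Union>v\<in>V. A v) \<and> card B \<le> s * r \<and> (\<forall>v\<in>V. A v \<inter> B \<noteq> {})"
proof (cases "V = {}")
  case False
  \<comment> \<open>Points from all of \<open>V\<close> are allowed, because the greedy edges that
    give the final cover need not belong to \<open>W\<close>. The inclusion also keeps
    \<open>B\<close> finite, so that the bound on its cardinality has content.\<close>
  define cov where "cov W B \<longleftrightarrow> B \<subseteq> (\<Union>v\<in>V. A v) \<and> card B \<le> s * r \<and> (\<forall>v\<in>W. A v \<inter> B \<noteq> {})" for W B
  show ?thesis
  proof (rule ccontr)
    assume "\<not> ?thesis"
    then have "V \<in> {W \<in> Pow V. \<nexists>B. cov W B}" by (auto simp: cov_def)
    moreover have "finite {W \<in> Pow V. \<nexists>B. cov W B}" using V by simp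
    ultimately obtain W where "W \<in> {W \<in> Pow V. \<nexists>B. cov W B}"
      and min: "\<forall>W'\<in>{W \<in> Pow V. \<nexists>B. cov W B}. W' \<subseteq> W \<longrightarrow> W = W'"
      using finite_has_minimal2 by meson
    then have W: "W \<subseteq> V" "\<nexists>B. cov W B" by auto
    have finW: "finite W" using W V finite_subset by blast
    have finA: "finite (\<Union>v\<in>V. A v)" using V A by auto
    have "\<exists>B. cov (W - {u}) B" if "u \<in> W" for u
    proof (rule ccontr)
      assume "\<nexists>B. cov (W - {u}) B"
      then have "W - {u} \<in> {W \<in> Pow V. \<nexists>B. cov W B}" using W(1) by blast
      then have "W = W - {u}" using min by blast
      then show False using that by blast
    qed
    then obtain B where B: "\<And>u. u \<in> W \<Longrightarrow> cov (W - {u}) (B u)" by metis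
    have finB: "finite (B u)" if "u \<in> W" for u
      using B[OF that] finite_subset[OF _ finA] by (simp add: cov_def)
    \<comment> \<open>If \<open>B u\<close> met \<open>A u\<close> as well, it would cover all of
      \<open>W\<close>.\<close>
    have disj: "A u \<inter> B u = {}" if "u \<in> W" for u
      using B[OF that] W(2) unfolding cov_def by blast
    have cross: "A u \<inter> B v \<noteq> {}" if "u \<in> W" "v \<in> W" "u \<noteq> v" for u v
      using B[OF that(2)] that unfolding cov_def by blast
    have "real (card W) * (p ^ r * (1 - p) ^ (s * r)) = (\<Sum>u\<in>W. p ^ r * (1 - p) ^ (s * r))" by simp
    also have "\<dots> \<le> (\<Sum>u\<in>W. p ^ card (A u) * (1 - p) ^ card (B u))"
    proof (intro sum_mono mult_mono)
      fix u assume "u \<in> W"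
      then show "p ^ r \<le> p ^ card (A u)" "(1 - p) ^ (s * r) \<le> (1 - p) ^ card (B u)"
        using A W(1) B[of u] p by (auto simp: cov_def intro!: power_decreasing)
    qed (use p in auto)
    also have "\<dots> \<le> 1"
      using finW finB disj cross p A W(1) by (intro set_pair_inequality) auto
    finally have small: "real (card W) * (p ^ r * (1 - p) ^ (s * r)) \<le> 1" .
    have "W \<noteq> {}"
    proof
      assume "W = {}"
      then have "cov W {}" by (simp add: cov_def)
      then show False using W(2) by blast
    qed
    then have "0 < card W" using finW by (simp add: card_gt_0_iff)
    then have "real (card W) * \<delta> ^ s < real (card W) * (p ^ r * (1 - p) ^ (s * r))"
      using s by (intro mult_strict_left_mono) auto
    then have "\<delta> ^ s * real (card W) < 1" using small by (simp only: mult.commute)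
    moreover obtain D where D: "D \<subseteq> V" "finite D" "card D \<le> s"
      "real (card {w \<in> W. \<forall>v\<in>D. A v \<inter> A w = {}}) \<le> \<delta> ^ s * real (card W)"
      using ex_vertices_meeting_most[OF V False W(1) \<delta> few] by blast
    ultimately have "card {w \<in> W. \<forall>v\<in>D. A v \<inter> A w = {}} = 0" by linarith
    then have hit: "\<forall>w\<in>W. \<exists>v\<in>D. A v \<inter> A w \<noteq> {}" using finW by auto
    have "card (\<Union>v\<in>D. A v) \<le> (\<Sum>v\<in>D. card (A v))" by (rule card_UN_le) (rule D)
    also have "\<dots> \<le> (\<Sum>v\<in>D. r)" using A D(1) by (intro sum_mono) auto
    also have "\<dots> \<le> s * r" using D(3) by simp
    finally have "cov W (\<Union>v\<in>D. A v)" using D(1) hit unfolding cov_def by blast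
    then show False using W(2) by blast
  qed
qed auto

section \<open>Monochromatic components and trees\<close>

text \<open>An inclusion-minimal connected edge set has no cycle: deleting an edge of a cycle
  preserves connectedness, as the rest of the cycle is a detour.\<close>

lemma spanning_tree_exists:
  assumes simple: "simple_graph W F" and conn: "connected_graph W F"
  shows "\<exists>F'\<subseteq>F. is_tree W F'"
proof -
  have "F \<subseteq> Pow W" "finite W" using simple by (auto simp: simple_graph_def)
  then have "finite F" by (meson finite_Pow_iff finite_subset)
  then have "finite {F' \<in> Pow F. connected_graph W F'}" by simp
  moreover have "F \<in> {F' \<in> Pow F. connected_graph W F'}" using conn by simp
  ultimately obtain F' where "F' \<in> {F' \<in> Pow F. connected_graph W F'}"
    and min: "\<forall>F''\<in>{F' \<in> Pow F. connected_graph W F'}. F'' \<subseteq> F' \<longrightarrow> F' = F''"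
    using finite_has_minimal2 by meson
  then have F': "F' \<subseteq> F" "connected_graph W F'" by auto
  have "\<not> is_cycle F' vs" for vs
  proof
    assume cyc: "is_cycle F' vs"
    define k where "k = length vs - 1"
    have k: "k \<ge> 2" "length vs = Suc k" and dist: "distinct vs"
      and edge: "\<And>i. i < length vs \<Longrightarrow> {vs ! i, vs ! (Suc i mod length vs)} \<in> F'"
      using cyc by (auto simp: is_cycle_def k_def)
    \<comment> \<open>The closing edge of the cycle; \<open>R\<close> is adjacency without it, and
      the remaining edges form a path from \<open>vs ! 0\<close> to \<open>vs ! k\<close>.\<close>
    define e where "e = {vs ! k, vs ! 0}"
    define R where "R = {(x, y). {x, y} \<in> F' - {e}}"
    have e: "e \<in> F'" using edge[of k] k by (simp add: e_def)
    have symR: "sym R" by (auto simp: R_def sym_def insert_commute)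
    have step: "(vs ! i, vs ! Suc i) \<in> R" if "i < k" for i
    proof -
      have "{vs ! i, vs ! Suc i} \<in> F'" using edge[of i] that k by simp
      \<comment> \<open>The reversed orientation would force \<open>i = 0\<close> and
        \<open>k = 1\<close>; it is excluded because a cycle has at least three vertices.\<close>
      moreover have "{vs ! i, vs ! Suc i} \<noteq> e"
      proof
        assume "{vs ! i, vs ! Suc i} = e"
        then have "vs ! i = vs ! k \<and> vs ! Suc i = vs ! 0 \<or> vs ! i = vs ! 0 \<and> vs ! Suc i = vs ! k"
          by (auto simp: e_def doubleton_eq_iff)
        then show False using that k dist by (auto simp: nth_eq_iff_index_eq)
      qed
      ultimately show ?thesis by (simp add: R_def)
    qed
    have "(vs ! 0, vs ! i) \<in> R\<^sup>*" if "i \<le> k" for i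
      using that
    proof (induction i)
      case (Suc i)
      then show ?case using step[of i] by (auto intro: rtrancl_into_rtrancl)
    qed simp
    then have path: "(vs ! 0, vs ! k) \<in> R\<^sup>*" by simp
    then have path': "(vs ! k, vs ! 0) \<in> R\<^sup>*" using sym_rtrancl[OF symR] by (meson symD)
    have "{(x, y). {x, y} \<in> F'} \<subseteq> R\<^sup>*"
    proof clarify
      fix x y assume xy: "{x, y} \<in> F'"
      show "(x, y) \<in> R\<^sup>*"
      proof (cases "{x, y} = e")
        case True
        then show ?thesis using path path' by (auto simp: e_def doubleton_eq_iff)
      next
        case False
        then have "(x, y) \<in> R" using xy by (simp add: R_def)
        then show ?thesis by blast
      qed
    qed
    then have "{(x, y). {x, y} \<in> F'}\<^sup>* \<subseteq> R\<^sup>*" by (rule rtrancl_subset_rtrancl)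
    then have "connected_graph W (F' - {e})"
      using F'(2) unfolding connected_graph_def R_def by blast
    then have "F' = F' - {e}" using min F'(1) by blast
    then show False using e by blast
  qed
  then have "is_tree W F'" using F' simple by (auto simp: is_tree_def simple_graph_def)
  then show ?thesis using F'(1) by blast
qed

section \<open>Components as vertex sets of monochromatic trees\<close>

text \<open>The closure is reflexive, so a vertex without edges of colour \<open>c\<close> forms a
  component by itself.\<close>

definition component :: "'a col_graph \<Rightarrow> nat \<Rightarrow> 'a \<Rightarrow> 'a set" where
  "component G c v = {(x, y). {x, y} \<in> edges G \<and> colour G {x, y} = c}\<^sup>* `` {v}"

lemma self_in_component: "v \<in> component G c v"
  by (simp add: component_def)

lemma component_adjacent: "{v, w} \<in> edges G \<Longrightarrow> w \<in> component G (colour G {v, w}) v"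
  by (auto simp: component_def)

lemma component_eq:
  assumes "w \<in> component G c v"
  shows "component G c w = component G c v"
proof -
  define R where "R = {(x, y). {x, y} \<in> edges G \<and> colour G {x, y} = c}"
  have "sym (R\<^sup>*)" by (intro sym_rtrancl) (auto simp: R_def sym_def insert_commute)
  moreover have "(v, w) \<in> R\<^sup>*" using assms by (simp add: component_def R_def)
  ultimately show ?thesis
    unfolding component_def R_def[symmetric] by (auto dest: symD intro: rtrancl_trans)
qed

lemma component_subset_verts:
  assumes "edge_coloured r G" "v \<in> verts G"
  shows "component G c v \<subseteq> verts G"
proof
  fix w assume "w \<in> component G c v"
  then have "(v, w) \<in> {(x, y). {x, y} \<in> edges G \<and> colour G {x, y} = c}\<^sup>*"
    by (simp add: component_def)
  then show "w \<in> verts G"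
    by induction (use assms in \<open>auto simp: edge_coloured_def simple_graph_def\<close>)
qed

lemma component_spanned_by_mono_tree:
  assumes G: "edge_coloured r G" and v: "v \<in> verts G"
  shows "\<exists>T. mono_tree G T \<and> fst T = component G c v"
proof -
  define C where "C = component G c v"
  define R where "R = {(x, y). {x, y} \<in> edges G \<and> colour G {x, y} = c}"
  define F where "F = {e \<in> edges G. colour G e = c \<and> e \<subseteq> C}"
  define S where "S = {(x, y). {x, y} \<in> F}"
  have CV: "C \<subseteq> verts G" using component_subset_verts[OF G v] by (simp add: C_def)
  have simple: "simple_graph C F"
    using G CV finite_subset[OF CV] by (auto simp: edge_coloured_def simple_graph_def F_def)
  have CR: "C = R\<^sup>* `` {v}" by (simp add: C_def component_def R_def)
  \<comment> \<open>A path of colour \<open>c\<close> from \<open>v\<close> never leaves the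
    component, so all its edges lie in \<open>F\<close>.\<close>
  have reach: "(v, w) \<in> S\<^sup>*" if "(v, w) \<in> R\<^sup>*" for w
    using that
  proof induction
    case (step x y)
    then have "x \<in> C" "y \<in> C" by (auto simp: CR)
    then have "(x, y) \<in> S" using step by (auto simp: S_def F_def R_def)
    then show ?case using step by (meson rtrancl_into_rtrancl)
  qed simp
  have "sym (S\<^sup>*)" by (intro sym_rtrancl) (auto simp: S_def sym_def insert_commute)
  then have "connected_graph C F"
    unfolding connected_graph_def S_def[symmetric]
    using reach by (auto simp: CR dest: symD intro: rtrancl_trans)
  then obtain F' where "F' \<subseteq> F" "is_tree C F'" using spanning_tree_exists[OF simple] by blast
  moreover from this have "\<forall>e\<in>F'. colour G e = c" "F' \<subseteq> edges G" by (auto simp: F_def)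
  ultimately have "mono_tree G (C, F')" using CV by (auto simp: mono_tree_def)
  then show ?thesis by (auto simp: C_def)
qed

lemma tc_le_card_cover:
  assumes "finite \<T>" "\<And>T. T \<in> \<T> \<Longrightarrow> mono_tree G T" "(\<Union>T\<in>\<T>. fst T) = verts G"
  shows "tc G \<le> card \<T>"
  unfolding tc_def using assms by (intro Least_le) blast

text \<open>Every listed component is replaced by a monochromatic tree spanning it. The colour tag
  keeps components of different colours apart even if their vertex sets coincide; the trees chosen
  may coincide, which only lowers the count.\<close>

lemma tc_le_card_components:
  assumes G: "edge_coloured r G" and fin: "finite B"
    and B: "B \<subseteq> (\<lambda>(c, v). (c, component G c v)) ` (UNIV \<times> verts G)"
    and cover: "verts G \<subseteq> (\<Union>(c, C)\<in>B. C)"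
  shows "tc G \<le> card B"
proof -
  have "\<exists>T. mono_tree G T \<and> fst T = snd x" if "x \<in> B" for x
    using B that component_spanned_by_mono_tree[OF G] by fastforce
  then obtain f where f: "\<And>x. x \<in> B \<Longrightarrow> mono_tree G (f x) \<and> fst (f x) = snd x" by metis
  have "(\<Union>T\<in>f ` B. fst T) = verts G"
  proof
    show "(\<Union>T\<in>f ` B. fst T) \<subseteq> verts G" using f unfolding mono_tree_def by blast
    show "verts G \<subseteq> (\<Union>T\<in>f ` B. fst T)" using f cover by fastforce
  qed
  then have "tc G \<le> card (f ` B)" using fin f by (intro tc_le_card_cover) auto
  then show ?thesis using card_image_le[OF fin, of f] by linarith
qed

section \<open>Degrees and numbers of neighbours\<close>

lemma degree_eq_card_neighbours:
  assumes "edge_coloured r G"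
  shows "degree G v = card {w \<in> verts G. {v, w} \<in> edges G}"
proof -
  have E: "\<And>e. e \<in> edges G \<Longrightarrow> e \<subseteq> verts G \<and> card e = 2"
    using assms by (auto simp: edge_coloured_def simple_graph_def)
  have "bij_betw (\<lambda>w. {v, w}) {w \<in> verts G. {v, w} \<in> edges G} {e \<in> edges G. v \<in> e}"
    unfolding bij_betw_def
  proof
    show "inj_on (\<lambda>w. {v, w}) {w \<in> verts G. {v, w} \<in> edges G}"
      by (auto simp: inj_on_def doubleton_eq_iff)
    show "(\<lambda>w. {v, w}) ` {w \<in> verts G. {v, w} \<in> edges G} = {e \<in> edges G. v \<in> e}"
    proof safe
      fix e assume e: "e \<in> edges G" "v \<in> e"
      then obtain x y where "e = {x, y}" using E by (meson card_2_iff)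
      then obtain w where "e = {v, w}" using e(2) by auto
      then show "e \<in> (\<lambda>w. {v, w}) ` {w \<in> verts G. {v, w} \<in> edges G}"
        using e(1) E[OF e(1)] by auto
    qed
  qed
  from bij_betw_same_card[OF this] show ?thesis by (simp add: degree_def)
qed

lemma min_degree_le_degree:
  assumes "finite (verts G)" "v \<in> verts G"
  shows "min_degree G \<le> degree G v"
  unfolding min_degree_def using assms by (intro Min_le) auto

lemma graph_family_degree:
  assumes "G \<in> graph_family n r \<delta>" "v \<in> verts G"
  shows "(1 - \<delta>) * real n \<le> real (card {w \<in> verts G. {v, w} \<in> edges G})"
proof -
  have G: "edge_coloured r G" and "(1 - \<delta>) * real n \<le> real (min_degree G)"
    using assms by (auto simp: graph_family_def)
  moreover have "min_degree G \<le> degree G v"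
    using G assms(2) by (intro min_degree_le_degree) (auto simp: edge_coloured_def simple_graph_def)
  ultimately show ?thesis using degree_eq_card_neighbours[OF G, of v] by linarith
qed

section \<open>The upper bounds\<close>

text \<open>The hypergraph cover bound is applied with \<open>A v\<close> the set of tagged
  components containing \<open>v\<close>. Vertices with disjoint sets are not adjacent, so the
  minimum degree limits their number, and a set of points hitting every \<open>A v\<close> is a
  family of components covering the graph.\<close>

lemma tc_le_of_power_bound:
  fixes \<delta> p :: real
  assumes fam: "G \<in> graph_family n r \<delta>" and \<delta>: "0 \<le> \<delta>"
    and p: "0 < p" "p < 1" and s: "\<delta> ^ s < p ^ r * (1 - p) ^ (s * r)"
  shows "tc G \<le> s * r"
proof -
  define A where "A v = (\<lambda>c. (c, component G c v)) ` {1..r}" for v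
  have G: "edge_coloured r G" and n: "card (verts G) = n"
    using fam by (auto simp: graph_family_def)
  have finV: "finite (verts G)" using G by (simp add: edge_coloured_def simple_graph_def)
  have A: "finite (A v) \<and> card (A v) \<le> r" for v
    using card_image_le[of "{1..r}" "\<lambda>c. (c, component G c v)"] by (simp add: A_def)
  have few: "real (card {v \<in> verts G. A v \<inter> A w = {}}) \<le> \<delta> * real (card (verts G))"
    if w: "w \<in> verts G" for w
  proof -
    define N where "N = {v \<in> verts G. {w, v} \<in> edges G}"
    have meet: "A v \<inter> A w \<noteq> {}" if "{w, v} \<in> edges G" for v
    proof -
      define c where "c = colour G {w, v}"
      have "c \<in> {1..r}" using G that by (simp add: edge_coloured_def c_def)
      moreover have "component G c v = component G c w"
        using component_eq[OF component_adjacent[OF that]] by (simp add: c_def)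
      ultimately have "(c, component G c v) \<in> A v \<inter> A w" by (force simp: A_def)
      then show ?thesis by blast
    qed
    have "{v \<in> verts G. A v \<inter> A w = {}} \<subseteq> verts G - N"
      using meet by (auto simp: N_def)
    then have "card {v \<in> verts G. A v \<inter> A w = {}} \<le> card (verts G - N)"
      using finV by (intro card_mono) auto
    also have "card (verts G - N) = n - card N"
      using finV n by (subst card_Diff_subset) (auto simp: N_def)
    finally have "card {v \<in> verts G. A v \<inter> A w = {}} \<le> n - card N" .
    moreover have "card N \<le> n" using finV n card_mono[of "verts G" N] by (auto simp: N_def)
    moreover have "(1 - \<delta>) * real n \<le> real (card N)"
      using graph_family_degree[OF fam w] by (simp add: N_def)
    ultimately show ?thesis using n by (simp add: algebra_simps of_nat_diff)
  qed
  obtain B where B: "B \<subseteq> (\<Union>v\<in>verts G. A v)" "card B \<le> s * r" "\<forall>v\<in>verts G. A v \<inter> B \<noteq> {}"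
    using almost_intersecting_cover[of "verts G" A r \<delta> p s, OF finV A \<delta> few p s] by blast
  have "tc G \<le> card B"
  proof (rule tc_le_card_components[OF G])
    have "finite (\<Union>v\<in>verts G. A v)" using finV A by blast
    then show "finite B" using B(1) finite_subset by blast
    show "B \<subseteq> (\<lambda>(c, v). (c, component G c v)) ` (UNIV \<times> verts G)"
      using B(1) by (force simp: A_def)
    show "verts G \<subseteq> (\<Union>(c, C)\<in>B. C)"
    proof
      fix v assume "v \<in> verts G"
      then obtain c where "(c, component G c v) \<in> B" using B(3) by (fastforce simp: A_def)
      then show "v \<in> (\<Union>(c, C)\<in>B. C)" using self_in_component[of v G c] by blast
    qed
  qed
  then show ?thesis using B(2) by simp
qed

section \<open>Numerical estimates and the general upper bound\<close>

text \<open>The value \<open>p = 1 / (1 + s)\<close> maximises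
  \<open>p ^ r * (1 - p) ^ (s * r)\<close>. There the second factor is
  \<open>(1 + 1 / s) ^ (s * r)\<close> inverted, which exceeds \<open>exp (- r)\<close>, so the
  product exceeds \<open>exp (- r * (1 + ln (1 + s)))\<close>. In the application
  \<open>exp (- L)\<close> is \<delta>.\<close>

lemma power_bound_of_log_bound:
  fixes L :: real
  assumes "0 < s" "0 < r" and L: "real r * (1 + ln (1 + real s)) \<le> real s * L"
  shows "exp (- L) ^ s < (1 / (1 + real s)) ^ r * (1 - 1 / (1 + real s)) ^ (s * r)"
proof -
  have "ln (1 + 1 / real s) < 1 / real s"
    using assms(1) by (intro ln_add_one_self_less_self) simp
  then have "real (s * r) * ln (1 + 1 / real s) < real (s * r) * (1 / real s)"
    using assms by (intro mult_strict_left_mono) auto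
  then have "real (s * r) * ln (1 + 1 / real s) < real r" using assms(1) by simp
  then have *: "- (real s * L) < real r * (- ln (1 + real s)) + real (s * r) * (- ln (1 + 1 / real s))"
    using L by (simp add: algebra_simps)
  have p: "1 / (1 + real s) = exp (- ln (1 + real s))"
    by (simp add: exp_minus inverse_eq_divide)
  have "1 - 1 / (1 + real s) = inverse (1 + 1 / real s)"
    using assms(1) by (simp add: field_simps)
  also have "\<dots> = exp (- ln (1 + 1 / real s))"
    using assms(1) by (simp add: exp_minus add_pos_pos)
  finally have q: "1 - 1 / (1 + real s) = exp (- ln (1 + 1 / real s))" .
  have "exp (- L) ^ s = exp (- (real s * L))" by (simp flip: exp_of_nat_mult)
  also have "\<dots> < exp (real r * (- ln (1 + real s)) + real (s * r) * (- ln (1 + 1 / real s)))"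
    using * by simp
  also have "\<dots> = (1 / (1 + real s)) ^ r * (1 - 1 / (1 + real s)) ^ (s * r)"
    unfolding q unfolding p exp_add exp_of_nat_mult ..
  finally show ?thesis .
qed

text \<open>This makes \<open>s = 8 * y\<close> large enough when \<open>x = r / L\<close>. For
  \<open>x > 1\<close> the factor 8 is 6 + 2, from
  \<open>ln (1 + 8 * y) \<le> 6 * ln (1 + x)\<close> and \<open>1 \<le> 2 * ln (1 + x)\<close>; for
  \<open>x \<le> 1\<close> the rounding gives \<open>y = 1\<close>, and
  \<open>1 + ln 9 \<le> 8\<close> suffices.\<close>

lemma log_bound:
  fixes x y :: real
  assumes x: "0 < x" and y: "y = real_of_int \<lceil>x * ln (1 + x)\<rceil>"
  shows "x * (1 + ln (1 + 8 * y)) \<le> 8 * y"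
proof -
  have ln2: "1 / 2 \<le> ln (2::real)" using ln_le_minus_one[of "1 / 2 :: real"] by (simp add: ln_div)
  have lnx: "0 < ln (1 + x)" "ln (1 + x) \<le> x" using x by (auto intro: ln_add_one_self_le_self)
  have y1: "1 \<le> y"
  proof -
    have "0 < \<lceil>x * ln (1 + x)\<rceil>" using x lnx by simp
    then show ?thesis by (simp add: y)
  qed
  show ?thesis
  proof (cases "x \<le> 1")
    case True
    have "x * ln (1 + x) \<le> 1 * 1" using True x lnx by (intro mult_mono) auto
    then have "\<lceil>x * ln (1 + x)\<rceil> \<le> 1" by (simp add: ceiling_le_iff)
    then have "y = 1" using y y1 by linarith
    have "ln (9::real) \<le> ln (2 ^ 4)" by simp
    also have "\<dots> = 4 * ln (2::real)" using ln_realpow[of 2 4] by simp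
    also have "\<dots> \<le> 4" using ln_2_less_1 by simp
    finally have "1 + ln (9::real) \<le> 8" by simp
    moreover have "0 \<le> 1 + ln (9::real)" by (simp add: add_nonneg_nonneg)
    ultimately have "x * (1 + ln 9) \<le> 1 * 8" using True x by (intro mult_mono) auto
    then show ?thesis using \<open>y = 1\<close> by simp
  next
    case False
    have xx: "x * ln (1 + x) \<le> y" using y by (simp add: le_of_int_ceiling)
    have "x * ln (1 + x) \<le> x * x" using x lnx by simp
    moreover have "y \<le> x * ln (1 + x) + 1" using y ceiling_correct[of "x * ln (1 + x)"] by linarith
    ultimately have "1 + 8 * y \<le> 9 + 8 * (x * x)" by linarith
    also have "\<dots> \<le> 2 ^ 4 * (1 + x) ^ 2" using x by (simp add: power2_eq_square algebra_simps)
    finally have "ln (1 + 8 * y) \<le> ln (2 ^ 4 * (1 + x) ^ 2)" using y1 x by simp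
    also have "\<dots> = ln (2 ^ 4) + ln ((1 + x) ^ 2)" using x by (intro ln_mult_pos) auto
    also have "\<dots> = 4 * ln 2 + 2 * ln (1 + x)"
      using x ln_realpow[of 2 4] ln_realpow[of "1 + x" 2] by simp
    also have "\<dots> \<le> 6 * ln (1 + x)"
    proof -
      have "ln 2 \<le> ln (1 + x)" using False by simp
      then show ?thesis by simp
    qed
    finally have "ln (1 + 8 * y) \<le> 6 * ln (1 + x)" .
    moreover have "1 \<le> 2 * ln (1 + x)"
    proof -
      have "ln 2 \<le> ln (1 + x)" using False by simp
      then show ?thesis using ln2 by simp
    qed
    ultimately have "x * (1 + ln (1 + 8 * y)) \<le> x * (8 * ln (1 + x))"
      using x by (intro mult_left_mono) auto
    then show ?thesis using xx by simp
  qed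
qed

lemma tc_upper_bound:
  fixes \<delta> :: real
  assumes fam: "G \<in> graph_family n r \<delta>" and r: "0 < r" and \<delta>: "0 < \<delta>" "\<delta> < 1"
  shows "real (tc G) \<le> 8 * real r *
           real_of_int \<lceil>real r / ln (1 / \<delta>) * ln (1 + real r / ln (1 / \<delta>))\<rceil>"
proof -
  define L where "L = ln (1 / \<delta>)"
  define x where "x = real r / L"
  define y where "y = nat \<lceil>x * ln (1 + x)\<rceil>"
  define s where "s = 8 * y"
  have L: "0 < L" using \<delta> by (simp add: L_def)
  then have x: "0 < x" using r by (simp add: x_def)
  \<comment> \<open>The ceiling is positive, so \<open>nat\<close> loses nothing and
    \<open>s\<close> is positive.\<close>
  have pos: "0 < \<lceil>x * ln (1 + x)\<rceil>" using x by simp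
  then have y: "real y = real_of_int \<lceil>x * ln (1 + x)\<rceil>" "0 < y" by (auto simp: y_def)
  have "x * (1 + ln (1 + real s)) \<le> real s" using log_bound[OF x y(1)] by (simp add: s_def)
  then have "real r * (1 + ln (1 + real s)) \<le> real s * L"
    using L by (simp add: x_def field_simps)
  then have "exp (- L) ^ s < (1 / (1 + real s)) ^ r * (1 - 1 / (1 + real s)) ^ (s * r)"
    using y r by (intro power_bound_of_log_bound) (auto simp: s_def)
  moreover have "exp (- L) = \<delta>" using \<delta> by (simp add: L_def ln_div)
  ultimately have "tc G \<le> s * r"
    using \<open>0 < y\<close> \<delta> by (intro tc_le_of_power_bound[OF fam, of "1 / (1 + real s)"]) (auto simp: s_def)
  then have "real (tc G) \<le> real (s * r)" by (simp only: of_nat_le_iff)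
  also have "real (s * r) = 8 * real r * real_of_int \<lceil>x * ln (1 + x)\<rceil>"
    unfolding y(1)[symmetric] by (simp add: s_def)
  finally show ?thesis by (simp only: x_def L_def)
qed

section \<open>Large components and the bound for \<delta> at least 1/2\<close>

text \<open>All neighbours of a vertex lie in its \<open>r\<close> components, so one of these has
  at least \<open>(1 - \<delta>) * n / r\<close> vertices. Components of one colour are disjoint,
  hence each colour has at most \<open>r / (1 - \<delta>)\<close> components of this size.\<close>

lemma tc_le_large_components:
  fixes \<delta> :: real
  assumes fam: "G \<in> graph_family n r \<delta>" and n: "0 < n" and r: "0 < r" and \<delta>: "\<delta> < 1"
  shows "real (tc G) \<le> real r * (real r / (1 - \<delta>))"
proof -
  have G: "edge_coloured r G" and card_V: "card (verts G) = n"
    using fam by (auto simp: graph_family_def)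
  have finV: "finite (verts G)" using G by (simp add: edge_coloured_def simple_graph_def)
  define K where "K c = {C \<in> component G c ` verts G. (1 - \<delta>) * real n \<le> real r * real (card C)}" for c
  have finK: "finite (K c)" for c using finV by (simp add: K_def)
  have sub: "C \<subseteq> verts G" if "C \<in> K c" for C c
    using that component_subset_verts[OF G] by (auto simp: K_def)
  have cardK: "real (card (K c)) \<le> real r / (1 - \<delta>)" for c
  proof -
    have disj: "C = D" if "C \<in> K c" "D \<in> K c" "z \<in> C" "z \<in> D" for C D z
      using that component_eq[of z G c] unfolding K_def by (metis (no_types, lifting) imageE mem_Collect_eq)
    have "pairwise disjnt (K c)"
      unfolding pairwise_def disjnt_def using disj by blast
    then have "(\<Sum>C\<in>K c. card C) = card (\<Union>(K c))"
      using finite_subset[OF sub finV] by (intro card_Union_disjoint[symmetric])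
    also have "\<dots> \<le> n" using sub card_mono[OF finV, of "\<Union>(K c)"] unfolding card_V by blast
    finally have "(\<Sum>C\<in>K c. real (card C)) \<le> real n" by (simp flip: of_nat_sum)
    then have "real r * (\<Sum>C\<in>K c. real (card C)) \<le> real r * real n" by (simp add: mult_left_mono)
    moreover have "(\<Sum>C\<in>K c. (1 - \<delta>) * real n) \<le> (\<Sum>C\<in>K c. real r * real (card C))"
      by (intro sum_mono) (simp add: K_def)
    ultimately have "real (card (K c)) * ((1 - \<delta>) * real n) \<le> real r * real n"
      by (simp add: sum_distrib_left)
    then have "real (card (K c)) * (1 - \<delta>) * real n \<le> real r * real n" by (simp only: mult.assoc)
    then have "real (card (K c)) * (1 - \<delta>) \<le> real r" using n by simp
    then show ?thesis using \<delta> by (simp add: pos_le_divide_eq)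
  qed
  have "tc G \<le> card (SIGMA c:{1..r}. K c)"
  proof (rule tc_le_card_components[OF G])
    show "finite (SIGMA c:{1..r}. K c)" using finK by auto
    show "(SIGMA c:{1..r}. K c) \<subseteq> (\<lambda>(c, v). (c, component G c v)) ` (UNIV \<times> verts G)"
      by (auto simp: K_def)
    show "verts G \<subseteq> (\<Union>(c, C)\<in>(SIGMA c:{1..r}. K c). C)"
    proof
      fix v assume v: "v \<in> verts G"
      have "\<exists>c\<in>{1..r}. component G c v \<in> K c"
      proof (rule ccontr)
        assume "\<not> ?thesis"
        then have small: "real r * real (card (component G c v)) < (1 - \<delta>) * real n" if "c \<in> {1..r}" for c
          using that v by (force simp: K_def)
        have "{w \<in> verts G. {v, w} \<in> edges G} \<subseteq> (\<Union>c\<in>{1..r}. component G c v)"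
          using component_adjacent[of v _ G] G by (fastforce simp: edge_coloured_def)
        moreover have fin: "finite (component G c v)" for c
          using component_subset_verts[OF G v] finV by (rule finite_subset)
        ultimately have "card {w \<in> verts G. {v, w} \<in> edges G} \<le> card (\<Union>c\<in>{1..r}. component G c v)"
          by (intro card_mono) auto
        also have "\<dots> \<le> (\<Sum>c\<in>{1..r}. card (component G c v))" by (rule card_UN_le) simp
        finally have "real (card {w \<in> verts G. {v, w} \<in> edges G}) \<le> (\<Sum>c\<in>{1..r}. real (card (component G c v)))"
          by (simp flip: of_nat_sum)
        then have "real r * ((1 - \<delta>) * real n) \<le> real r * (\<Sum>c\<in>{1..r}. real (card (component G c v)))"
          using graph_family_degree[OF fam v] by (intro mult_left_mono) auto
        also have "\<dots> = (\<Sum>c\<in>{1..r}. real r * real (card (component G c v)))" by (rule sum_distrib_left)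
        also have "\<dots> < (\<Sum>c\<in>{1..r}. (1 - \<delta>) * real n)" using small r by (intro sum_strict_mono) auto
        finally show False by simp
      qed
      then show "v \<in> (\<Union>(c, C)\<in>(SIGMA c:{1..r}. K c). C)" using self_in_component by fastforce
    qed
  qed
  also have "\<dots> = (\<Sum>c\<in>{1..r}. card (K c))" using finK by simp
  finally have "real (tc G) \<le> (\<Sum>c\<in>{1..r}. real (card (K c)))" by (simp flip: of_nat_sum)
  also have "\<dots> \<le> (\<Sum>c\<in>{1..r}. real r / (1 - \<delta>))" by (intro sum_mono cardK)
  finally show ?thesis by simp
qed

text \<open>For \<delta> at least 1/2, \<open>ln (1 / \<delta>) \<le> (1 - \<delta>) / \<delta>
  \<le> 2 * (1 - \<delta>)\<close>, so the count of large components can be expressed through the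
  logarithm.\<close>

lemma tc_upper_bound_sparse:
  fixes \<delta> :: real
  assumes fam: "G \<in> graph_family n r \<delta>" and n: "0 < n" and r: "0 < r" and \<delta>: "1 / 2 \<le> \<delta>" "\<delta> < 1"
  shows "real (tc G) \<le> 2 * (real r)\<^sup>2 / ln (1 / \<delta>)"
proof -
  have "ln (1 / \<delta>) \<le> 1 / \<delta> - 1" using \<delta> by (intro ln_le_minus_one) auto
  also have "\<dots> = (1 - \<delta>) / \<delta>" using \<delta> by (simp add: field_simps)
  also have "\<dots> \<le> (1 - \<delta>) / (1 / 2)" using \<delta> by (intro divide_left_mono) auto
  finally have L: "ln (1 / \<delta>) \<le> 2 * (1 - \<delta>)" by simp
  have "0 < ln (1 / \<delta>)" using \<delta> by simp
  then have "2 * (real r)\<^sup>2 / (2 * (1 - \<delta>)) \<le> 2 * (real r)\<^sup>2 / ln (1 / \<delta>)"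
    using L \<delta> by (intro divide_left_mono) auto
  moreover have "real (tc G) \<le> 2 * (real r)\<^sup>2 / (2 * (1 - \<delta>))"
    using tc_le_large_components[OF fam n r \<delta>(2)] mult_divide_mult_cancel_left[of 2 "(real r)\<^sup>2" "1 - \<delta>"]
    by (simp only: power2_eq_square times_divide_eq_right)
  ultimately show ?thesis by linarith
qed

text \<open>A limit superior ignores finitely many terms, so \<open>n = 0\<close>, where the minimum
  degree is unspecified, can be left out.\<close>

lemma tc_lim_le:
  assumes "\<And>n G. 0 < n \<Longrightarrow> G \<in> graph_family n r \<delta> \<Longrightarrow> real (tc G) \<le> b"
  shows "tc_lim r \<delta> \<le> ereal b"
  unfolding tc_lim_def
proof (rule Limsup_bounded)
  show "\<forall>\<^sub>F n in sequentially. (SUP G\<in>graph_family n r \<delta>. ereal (real (tc G))) \<le> ereal b"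
    using eventually_gt_at_top[of 0] by eventually_elim (auto intro!: SUP_least assms)
qed

section \<open>The lower bound\<close>

text \<open>A lower bound for all covers passes to the \<open>LEAST\<close> value once some cover
  exists; the single-vertex trees provide one.\<close>

lemma le_tc:
  assumes G: "edge_coloured r G"
    and b: "\<And>\<T>. finite \<T> \<Longrightarrow> \<forall>T\<in>\<T>. mono_tree G T \<Longrightarrow> (\<Union>T\<in>\<T>. fst T) = verts G \<Longrightarrow> b \<le> card \<T>"
  shows "b \<le> tc G"
proof -
  define P where "P m \<longleftrightarrow> (\<exists>\<T>. finite \<T> \<and> card \<T> = m \<and> (\<forall>T\<in>\<T>. mono_tree G T) \<and>
    (\<Union>T\<in>\<T>. fst T) = verts G)" for m
  define \<S> where "\<S> = (\<lambda>v. ({v}, {} :: 'a set set)) ` verts G"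
  have "finite \<S>" using G by (simp add: \<S>_def edge_coloured_def simple_graph_def)
  moreover have "\<not> is_cycle {} vs" for vs :: "'a list"
    using nth_mem[of 0 vs] by (force simp: is_cycle_def)
  then have "\<forall>T\<in>\<S>. mono_tree G T"
    by (auto simp: \<S>_def mono_tree_def is_tree_def simple_graph_def connected_graph_def)
  moreover have "(\<Union>T\<in>\<S>. fst T) = verts G" by (auto simp: \<S>_def)
  ultimately have "P (card \<S>)" unfolding P_def by blast
  then have "P (tc G)" unfolding tc_def P_def[symmetric] by (rule LeastI)
  then obtain \<T> where "finite \<T>" "card \<T> = tc G" "\<forall>T\<in>\<T>. mono_tree G T"
    "(\<Union>T\<in>\<T>. fst T) = verts G"
    unfolding P_def by blast
  then show ?thesis using b[of \<T>] by simp
qed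

text \<open>A label records in which colours a vertex lies in one of \<open>m\<close> big components, and in which
  one of them. In the remaining colours the vertex will be isolated.\<close>

definition labels :: "nat \<Rightarrow> nat \<Rightarrow> nat \<Rightarrow> (nat set \<times> (nat \<Rightarrow> nat)) set" where
  "labels r q m = (SIGMA S:{S. S \<subseteq> {1..r} \<and> card S = q}. S \<rightarrow>\<^sub>E {..<m})"

definition agree :: "nat \<Rightarrow> nat set \<times> (nat \<Rightarrow> nat) \<Rightarrow> nat set \<times> (nat \<Rightarrow> nat) \<Rightarrow> bool" where
  "agree c g h \<longleftrightarrow> c \<in> fst g \<and> c \<in> fst h \<and> snd g c = snd h c"

lemma finite_labels: "finite (labels r q m)"
  unfolding labels_def
  by (intro finite_SigmaI finite_PiE) (auto intro: finite_subset[OF _ finite_atLeastAtMost])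

lemma labels_nonempty:
  assumes "q \<le> r" "0 < m"
  shows "labels r q m \<noteq> {}"
proof -
  have "(\<lambda>c\<in>{1..q}. 0) \<in> {1..q} \<rightarrow>\<^sub>E {..<m}" using assms by auto
  then have "({1..q}, \<lambda>c\<in>{1..q}. 0) \<in> labels r q m" using assms by (auto simp: labels_def)
  then show ?thesis by blast
qed

text \<open>Two \<open>q\<close>-subsets of \<open>{1..r}\<close> share at least
  \<open>2 * q - r\<close> colours. For a fixed colour set of \<open>h\<close>, each shared colour
  forbids one of \<open>m\<close> values and so contributes a factor
  \<open>1 - 1 / m\<close>.\<close>

lemma card_labels_disagree:
  assumes g: "g \<in> labels r q m" and m: "0 < m"
  shows "real (card {h \<in> labels r q m. \<forall>c. \<not> agree c g h}) \<le>
           (1 - 1 / real m) ^ (2 * q - r) * real (card (labels r q m))"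
proof -
  obtain S f where gSf: "g = (S, f)" by (cases g)
  then have S: "S \<subseteq> {1..r}" "card S = q" and f: "f \<in> S \<rightarrow>\<^sub>E {..<m}"
    using g by (auto simp: labels_def)
  define \<F> where "\<F> = {S. S \<subseteq> {1..r} \<and> card S = q}"
  have fin\<F>: "finite \<F>" by (simp add: \<F>_def)
  have finS': "finite S'" if "S' \<in> \<F>" for S'
    using that finite_subset[of S' "{1..r}"] by (simp add: \<F>_def)
  \<comment> \<open>The values at \<open>c\<close> that do not create an agreement with
    \<open>f\<close>; the disagreeing labels then form a disjoint union of products.\<close>
  define Q where "Q c = (if c \<in> S then {..<m} - {f c} else {..<m})" for c
  define \<beta> where "\<beta> = 1 - 1 / real m"
  have \<beta>: "0 \<le> \<beta>" "\<beta> \<le> 1" using m by (auto simp: \<beta>_def)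
  have cardQ: "real (card (Q c)) = (if c \<in> S then \<beta> else 1) * real m" for c
  proof (cases "c \<in> S")
    case True
    then have "f c < m" using f by auto
    then show ?thesis using True m by (simp add: Q_def \<beta>_def of_nat_diff field_simps)
  qed (simp add: Q_def)
  have "{h \<in> labels r q m. \<forall>c. \<not> agree c g h} = (SIGMA S':\<F>. PiE S' Q)"
  proof (intro set_eqI iffI)
    fix h assume "h \<in> {h \<in> labels r q m. \<forall>c. \<not> agree c g h}"
    then show "h \<in> (SIGMA S':\<F>. PiE S' Q)"
      by (cases h) (auto simp: labels_def agree_def gSf \<F>_def Q_def PiE_iff)
  next
    fix h assume "h \<in> (SIGMA S':\<F>. PiE S' Q)"
    then obtain S' f' where h: "h = (S', f')" "S' \<in> \<F>" "f' \<in> PiE S' Q" by blast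
    have "Q c \<subseteq> {..<m}" for c by (auto simp: Q_def)
    then have "f' \<in> S' \<rightarrow>\<^sub>E {..<m}" using h(3) PiE_mono[of S' Q "\<lambda>_. {..<m}"] by blast
    moreover have "f' c \<noteq> f c" if "c \<in> S" "c \<in> S'" for c
      using PiE_mem[OF h(3) that(2)] that(1) by (simp add: Q_def)
    then have "\<not> agree c g h" for c using h(1) by (force simp: agree_def gSf)
    ultimately show "h \<in> {h \<in> labels r q m. \<forall>c. \<not> agree c g h}"
      using h(1,2) by (auto simp: labels_def \<F>_def)
  qed
  then have "real (card {h \<in> labels r q m. \<forall>c. \<not> agree c g h}) = (\<Sum>S'\<in>\<F>. real (card (PiE S' Q)))"
    using fin\<F> finS' by (simp add: finite_PiE Q_def)
  also have "\<dots> \<le> (\<Sum>S'\<in>\<F>. \<beta> ^ (2 * q - r) * real (card (S' \<rightarrow>\<^sub>E {..<m})))"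
  proof (rule sum_mono)
    fix S' assume S': "S' \<in> \<F>"
    have "card S + card S' = card (S \<union> S') + card (S \<inter> S')"
      using S finite_subset[OF S(1)] finS'[OF S'] by (intro card_Un_Int) auto
    moreover have "card (S \<union> S') \<le> r"
      using S S' card_mono[of "{1..r}" "S \<union> S'"] by (auto simp: \<F>_def)
    ultimately have "2 * q - r \<le> card (S' \<inter> S)" using S S' by (simp add: \<F>_def Int_commute)
    then have le: "\<beta> ^ card (S' \<inter> S) \<le> \<beta> ^ (2 * q - r)" using \<beta> by (intro power_decreasing) auto
    have "real (card (PiE S' Q)) = (\<Prod>c\<in>S'. (if c \<in> S then \<beta> else 1) * real m)"
      using finS'[OF S'] by (simp add: card_PiE cardQ)
    also have "\<dots> = (\<Prod>c\<in>S'. if c \<in> S then \<beta> else 1) * real m ^ card S'"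
      by (simp add: prod.distrib)
    also have "(\<Prod>c\<in>S'. if c \<in> S then \<beta> else 1) = \<beta> ^ card (S' \<inter> S)"
      using finS'[OF S'] by (simp add: prod.If_cases)
    also have "\<beta> ^ card (S' \<inter> S) * real m ^ card S' \<le> \<beta> ^ (2 * q - r) * real m ^ card S'"
      using le by (intro mult_right_mono) auto
    finally show "real (card (PiE S' Q)) \<le> \<beta> ^ (2 * q - r) * real (card (S' \<rightarrow>\<^sub>E {..<m}))"
      using finS'[OF S'] by (simp add: card_PiE)
  qed
  also have "\<dots> = \<beta> ^ (2 * q - r) * (\<Sum>S'\<in>\<F>. real (card (S' \<rightarrow>\<^sub>E {..<m})))"
    by (rule sum_distrib_left[symmetric])
  also have "(\<Sum>S'\<in>\<F>. real (card (S' \<rightarrow>\<^sub>E {..<m}))) = real (card (labels r q m))"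
    using fin\<F> finS' unfolding labels_def \<F>_def[symmetric] by (simp add: finite_PiE)
  finally show ?thesis by (simp add: \<beta>_def)
qed

section \<open>The graph of a labelling and its monochromatic trees\<close>

text \<open>The colour has to be read off from an unordered pair, hence the symmetric condition on
  all members of \<open>e\<close>. Any colour in which the two ends agree may be picked.\<close>

definition label_graph :: "nat \<Rightarrow> nat \<Rightarrow> (nat \<Rightarrow> nat set \<times> (nat \<Rightarrow> nat)) \<Rightarrow> nat col_graph" where
  "label_graph n r \<phi> = \<lparr>verts = {..<n},
     edges = {{u, v} | u v. u < n \<and> v < n \<and> u \<noteq> v \<and> (\<exists>c\<in>{1..r}. agree c (\<phi> u) (\<phi> v))},
     colour = (\<lambda>e. SOME c. c \<in> {1..r} \<and> (\<forall>u\<in>e. \<forall>v\<in>e. agree c (\<phi> u) (\<phi> v)))\<rparr>"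

lemma label_graph_colour:
  assumes "e \<in> edges (label_graph n r \<phi>)"
  shows "colour (label_graph n r \<phi>) e \<in> {1..r} \<and>
    (\<forall>u\<in>e. \<forall>v\<in>e. agree (colour (label_graph n r \<phi>) e) (\<phi> u) (\<phi> v))"
proof -
  obtain u v c where "e = {u, v}" "c \<in> {1..r}" "agree c (\<phi> u) (\<phi> v)"
    using assms by (auto simp: label_graph_def)
  then have "c \<in> {1..r} \<and> (\<forall>u\<in>e. \<forall>v\<in>e. agree c (\<phi> u) (\<phi> v))" by (auto simp: agree_def)
  then have "\<exists>c. c \<in> {1..r} \<and> (\<forall>u\<in>e. \<forall>v\<in>e. agree c (\<phi> u) (\<phi> v))" ..
  from someI_ex[OF this] show ?thesis by (simp add: label_graph_def)
qed

lemma edge_coloured_label_graph: "edge_coloured r (label_graph n r \<phi>)"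
proof -
  have "simple_graph (verts (label_graph n r \<phi>)) (edges (label_graph n r \<phi>))"
    by (auto simp: simple_graph_def label_graph_def)
  then show ?thesis using label_graph_colour by (auto simp: edge_coloured_def)
qed

text \<open>Agreement in a fixed colour is transitive, so along the paths of a nontrivial tree of
  colour \<open>c\<close> the value at \<open>c\<close> stays constant.\<close>

lemma label_graph_mono_tree:
  assumes T: "mono_tree (label_graph n r \<phi>) T"
  shows "(\<exists>v. fst T = {v}) \<or> (\<exists>c\<in>{1..r}. \<exists>a. \<forall>u\<in>fst T. c \<in> fst (\<phi> u) \<and> snd (\<phi> u) c = a)"
proof (rule disjCI)
  assume not_trivial: "\<not> (\<exists>c\<in>{1..r}. \<exists>a. \<forall>u\<in>fst T. c \<in> fst (\<phi> u) \<and> snd (\<phi> u) c = a)"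
  define F where "F = {(x, y). {x, y} \<in> snd T}"
  obtain c where c: "\<And>e. e \<in> snd T \<Longrightarrow> colour (label_graph n r \<phi>) e = c"
    and sub: "snd T \<subseteq> edges (label_graph n r \<phi>)"
    and conn: "connected_graph (fst T) (snd T)"
    using T by (auto simp: mono_tree_def is_tree_def)
  have edge: "c \<in> {1..r} \<and> agree c (\<phi> x) (\<phi> y)" if "(x, y) \<in> F" for x y
  proof -
    have "{x, y} \<in> snd T" using that by (simp add: F_def)
    then show ?thesis using label_graph_colour[of "{x, y}" n r \<phi>] c[of "{x, y}"] sub by auto
  qed
  obtain u where u: "u \<in> fst T" using conn by (auto simp: connected_graph_def)
  have "w = u" if w: "w \<in> fst T" for w
  proof (rule ccontr)
    assume "w \<noteq> u"
    moreover have reach: "(u, v) \<in> F\<^sup>*" if "v \<in> fst T" for v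
      using conn u that by (auto simp: connected_graph_def F_def)
    \<comment> \<open>A path from \<open>u\<close> to another vertex starts with an edge, which
      shows that \<open>c\<close> is among the chosen colours of \<open>u\<close>.\<close>
    ultimately obtain y where "(u, y) \<in> F" using w by (metis converse_rtranclE)
    then have cu: "c \<in> {1..r}" "agree c (\<phi> u) (\<phi> u)" using edge by (auto simp: agree_def)
    have "agree c (\<phi> u) (\<phi> v)" if "(u, v) \<in> F\<^sup>*" for v
      using that
    proof induction
      case (step x y)
      then show ?case using edge[of x y] by (auto simp: agree_def)
    qed (rule cu)
    then have "\<forall>v\<in>fst T. c \<in> fst (\<phi> v) \<and> snd (\<phi> v) c = snd (\<phi> u) c"
      using reach unfolding agree_def by metis
    then show False using not_trivial cu(1) by blast
  qed
  then show "\<exists>v. fst T = {v}" using u by blast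
qed

text \<open>Fewer than \<open>m * (d + 1)\<close> big components exhaust at most \<open>d\<close> colours, so some label
  avoids all of them.\<close>

lemma ex_label_avoiding:
  assumes Q: "finite Q" "card Q < m * (d + 1)" and d: "d \<le> r"
  shows "\<exists>g\<in>labels r (r - d) m. \<forall>c\<in>fst g. (c, snd g c) \<notin> Q"
proof -
  define F where "F = {c \<in> {1..r}. \<forall>a<m. (c, a) \<in> Q}"
  have "F \<times> {..<m} \<subseteq> Q" by (auto simp: F_def)
  then have "card (F \<times> {..<m}) \<le> card Q" using Q(1) by (intro card_mono)
  then have "m * card F < m * (d + 1)" using Q(2) by (simp add: card_cartesian_product mult.commute)
  then have "card F < d + 1" by (rule mult_less_cancel1[THEN iffD1, THEN conjunct2])
  then have "card F \<le> d" by simp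
  moreover have "card ({1..r} - F) = r - card F" by (subst card_Diff_subset) (auto simp: F_def)
  ultimately have "r - d \<le> card ({1..r} - F)" by simp
  then obtain S where S: "S \<subseteq> {1..r} - F" "card S = r - d"
    by (rule obtain_subset_with_card_n)
  have "\<exists>a<m. (c, a) \<notin> Q" if "c \<in> S" for c using that S(1) by (auto simp: F_def)
  then obtain f where f: "\<And>c. c \<in> S \<Longrightarrow> f c < m \<and> (c, f c) \<notin> Q" by metis
  have "(S, restrict f S) \<in> labels r (r - d) m" using S f by (auto simp: labels_def)
  moreover have "\<forall>c\<in>S. (c, restrict f S c) \<notin> Q" using f by simp
  ultimately show ?thesis by force
qed

text \<open>With too few trees some label avoids every colour-value pair attached to a tree. Each of
  its copies must then be covered by a tree of its own consisting of that single vertex, and there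
  are too many copies for this.\<close>

lemma label_graph_le_tc:
  assumes copies: "\<And>g. g \<in> labels r (r - d) m \<Longrightarrow> m * (d + 1) \<le> card {v. v < n \<and> \<phi> v = g}"
    and d: "d \<le> r"
  shows "m * (d + 1) \<le> tc (label_graph n r \<phi>)"
proof (rule le_tc[OF edge_coloured_label_graph])
  fix \<T> assume fin: "finite \<T>" and mono: "\<forall>T\<in>\<T>. mono_tree (label_graph n r \<phi>) T"
    and cover: "(\<Union>T\<in>\<T>. fst T) = verts (label_graph n r \<phi>)"
  show "m * (d + 1) \<le> card \<T>"
  proof (rule ccontr)
    assume "\<not> m * (d + 1) \<le> card \<T>"
    then have small: "card \<T> < m * (d + 1)" by simp
    \<comment> \<open>A pair of colour and value for each tree; for a single-vertex tree any pair
      will do, so the number of pairs is still at most \<open>card \<T>\<close>.\<close>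
    have "\<exists>x. (\<exists>v. fst T = {v}) \<or> (\<forall>u\<in>fst T. fst x \<in> fst (\<phi> u) \<and> snd (\<phi> u) (fst x) = snd x)"
      if "T \<in> \<T>" for T
      using label_graph_mono_tree[of n r \<phi> T] mono that by (metis fst_conv snd_conv)
    then obtain \<kappa> where \<kappa>: "\<And>T. T \<in> \<T> \<Longrightarrow> (\<exists>v. fst T = {v}) \<or>
        (\<forall>u\<in>fst T. fst (\<kappa> T) \<in> fst (\<phi> u) \<and> snd (\<phi> u) (fst (\<kappa> T)) = snd (\<kappa> T))"
      by metis
    have "card (\<kappa> ` \<T>) < m * (d + 1)" using card_image_le[OF fin, of \<kappa>] small by linarith
    then obtain g where g: "g \<in> labels r (r - d) m" and avoid: "\<forall>c\<in>fst g. (c, snd g c) \<notin> \<kappa> ` \<T>"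
      using ex_label_avoiding[OF finite_imageI[OF fin] _ d, of \<kappa> m] by metis
    have "\<exists>T\<in>\<T>. fst T = {v}" if v: "v < n" "\<phi> v = g" for v
    proof -
      have "v \<in> (\<Union>T\<in>\<T>. fst T)" unfolding cover using v(1) by (simp add: label_graph_def)
      then obtain T where T: "T \<in> \<T>" "v \<in> fst T" by blast
      have "\<not> (fst (\<kappa> T) \<in> fst g \<and> snd g (fst (\<kappa> T)) = snd (\<kappa> T))"
      proof
        assume "fst (\<kappa> T) \<in> fst g \<and> snd g (fst (\<kappa> T)) = snd (\<kappa> T)"
        then have "\<kappa> T \<notin> \<kappa> ` \<T>" using avoid by (metis prod.collapse)
        then show False using T(1) by blast
      qed
      then have "\<exists>v. fst T = {v}" using \<kappa>[OF T(1)] T(2) v(2) by blast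
      then have "fst T = {v}" using T(2) by auto
      then show ?thesis using T(1) by (rule bexI)
    qed
    then have sub: "(\<lambda>v. {v}) ` {v. v < n \<and> \<phi> v = g} \<subseteq> fst ` \<T>" by blast
    have "card {v. v < n \<and> \<phi> v = g} = card ((\<lambda>v. {v}) ` {v. v < n \<and> \<phi> v = g})"
      by (simp add: card_image)
    also have "\<dots> \<le> card (fst ` \<T>)" using sub fin by (intro card_mono) auto
    also have "\<dots> \<le> card \<T>" by (rule card_image_le[OF fin])
    finally have "card {v. v < n \<and> \<phi> v = g} \<le> card \<T>" .
    then show False using copies[OF g] small by linarith
  qed
qed

section \<open>Blow-ups and their minimum degree\<close>

lemma ex_uniform_labelling:
  assumes "finite \<Lambda>"
  shows "\<exists>\<phi>. (\<forall>v<M * card \<Lambda>. \<phi> v \<in> \<Lambda>) \<and> (\<forall>g\<in>\<Lambda>. card {v. v < M * card \<Lambda> \<and> \<phi> v = g} = M)"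
proof -
  define n where "n = M * card \<Lambda>"
  have "card {..<n} = card (\<Lambda> \<times> {..<M})" by (simp add: card_cartesian_product n_def)
  then obtain h where h: "bij_betw h {..<n} (\<Lambda> \<times> {..<M})"
    using finite_same_card_bij[of "{..<n}" "\<Lambda> \<times> {..<M}"] assms by auto
  have "card {v. v < n \<and> fst (h v) = g} = M" if "g \<in> \<Lambda>" for g
  proof -
    have "h ` {v. v < n \<and> fst (h v) = g} = {g} \<times> {..<M}"
    proof
      show "h ` {v. v < n \<and> fst (h v) = g} \<subseteq> {g} \<times> {..<M}"
      proof
        fix x assume "x \<in> h ` {v. v < n \<and> fst (h v) = g}"
        then have "x \<in> h ` {..<n}" "fst x = g" by auto
        then show "x \<in> {g} \<times> {..<M}" using bij_betw_imp_surj_on[OF h] by (cases x) simp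
      qed
      show "{g} \<times> {..<M} \<subseteq> h ` {v. v < n \<and> fst (h v) = g}"
      proof
        fix x assume x: "x \<in> {g} \<times> {..<M}"
        then have "x \<in> h ` {..<n}" using that bij_betw_imp_surj_on[OF h] by auto
        then obtain v where "v < n" "x = h v" by auto
        moreover have "fst x = g" using x by auto
        ultimately show "x \<in> h ` {v. v < n \<and> fst (h v) = g}" by blast
      qed
    qed
    moreover have "inj_on h {v. v < n \<and> fst (h v) = g}"
      using bij_betw_imp_inj_on[OF h] by (rule inj_on_subset) auto
    ultimately show ?thesis using card_image[of h "{v. v < n \<and> fst (h v) = g}"]
      by (simp add: card_cartesian_product)
  qed
  moreover have "fst (h v) \<in> \<Lambda>" if "v < n" for v
    using bij_betw_apply[OF h, of v] that by (cases "h v") auto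
  ultimately show ?thesis unfolding n_def[symmetric] by (intro exI[of _ "\<lambda>v. fst (h v)"]) auto
qed

text \<open>Apart from \<open>v\<close> itself, the non-neighbours of \<open>v\<close> carry labels
  disagreeing with its own. All labels are equally frequent, so the fraction of such vertices equals
  the fraction of such labels.\<close>

lemma label_graph_in_family:
  fixes \<delta> :: real
  assumes m: "0 < m" and n: "n = M * card (labels r q m)" "0 < n"
    and label: "\<And>v. v < n \<Longrightarrow> \<phi> v \<in> labels r q m"
    and copies: "\<And>g. g \<in> labels r q m \<Longrightarrow> card {v. v < n \<and> \<phi> v = g} = M"
    and M: "1 \<le> (\<delta> - (1 - 1 / real m) ^ (2 * q - r)) * real n"
  shows "label_graph n r \<phi> \<in> graph_family n r \<delta>"
proof -
  define G where "G = label_graph n r \<phi>"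
  define \<beta> where "\<beta> = (1 - 1 / real m) ^ (2 * q - r)"
  have G: "edge_coloured r G" unfolding G_def by (rule edge_coloured_label_graph)
  have V: "verts G = {..<n}" by (simp add: G_def label_graph_def)
  have deg: "(1 - \<delta>) * real n \<le> real (degree G v)" if v: "v < n" for v
  proof -
    define D where "D = {h \<in> labels r q m. \<forall>c. \<not> agree c (\<phi> v) h}"
    define N where "N = {w \<in> verts G. {v, w} \<in> edges G}"
    define C where "C = (\<Union>h\<in>D. {w. w < n \<and> \<phi> w = h})"
    have "finite D" using finite_labels by (simp add: D_def)
    then have "card C \<le> (\<Sum>h\<in>D. card {w. w < n \<and> \<phi> w = h})" unfolding C_def by (rule card_UN_le)
    also have "\<dots> = card D * M" using copies by (simp add: D_def)
    finally have "real (card C) \<le> real (card D) * real M" by (simp flip: of_nat_mult)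
    also have "\<dots> \<le> (\<beta> * real (card (labels r q m))) * real M"
      using card_labels_disagree[OF label[OF v] m] by (intro mult_right_mono) (auto simp: D_def \<beta>_def)
    also have "\<dots> = \<beta> * real n" by (simp add: n)
    finally have C: "real (card C) \<le> \<beta> * real n" .
    \<comment> \<open>As \<open>v\<close> is not its own neighbour, it is counted separately; this
      is the 1 absorbed by hypothesis \<open>M\<close>.\<close>
    have "{..<n} \<subseteq> insert v (N \<union> C)"
    proof
      fix w assume w: "w \<in> {..<n}"
      show "w \<in> insert v (N \<union> C)"
      proof (cases "\<exists>c. agree c (\<phi> v) (\<phi> w)")
        case True
        then obtain c where c: "agree c (\<phi> v) (\<phi> w)" ..
        then have "c \<in> {1..r}" using label[OF v] by (auto simp: agree_def labels_def)
        then have "{v, w} \<in> edges G" if "w \<noteq> v"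
          using that c v w unfolding G_def label_graph_def by force
        then show ?thesis using w by (auto simp: N_def V)
      next
        case False
        then show ?thesis using w label by (auto simp: C_def D_def)
      qed
    qed
    moreover have "finite (insert v (N \<union> C))" using \<open>finite D\<close> by (auto simp: N_def V C_def)
    ultimately have "card {..<n} \<le> card (insert v (N \<union> C))" by (intro card_mono)
    also have "\<dots> \<le> Suc (card (N \<union> C))" by (rule card_insert_le_m1) auto
    also have "\<dots> \<le> Suc (card N + card C)" using card_Un_le by simp
    finally have "real n \<le> 1 + real (card N) + real (card C)" by simp
    moreover have "degree G v = card N" unfolding N_def by (rule degree_eq_card_neighbours[OF G])
    ultimately show ?thesis using C M by (simp add: \<beta>_def algebra_simps)
  qed
  have "min_degree G \<in> degree G ` verts G"
    unfolding min_degree_def using V n(2) by (intro Min_in) auto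
  then have "(1 - \<delta>) * real n \<le> real (min_degree G)" using deg V by auto
  then show ?thesis using G V by (simp add: graph_family_def G_def)
qed

text \<open>Graphs are built only for \<open>n\<close> a multiple of the number of labels, which is
  enough for a limit superior. The strict inequality leaves a gap \<open>\<delta> - \<beta>\<close>
  that pays for the missing loops once \<open>M\<close> is large.\<close>

lemma tc_lim_ge_labels:
  fixes \<delta> :: real
  assumes m: "0 < m" and d: "2 * d < r" and \<delta>: "(1 - 1 / real m) ^ (r - 2 * d) < \<delta>"
  shows "ereal (real (m * (d + 1))) \<le> tc_lim r \<delta>"
proof -
  define \<Lambda> where "\<Lambda> = labels r (r - d) m"
  define \<beta> where "\<beta> = (1 - 1 / real m) ^ (r - 2 * d)"
  define X where "X n = (SUP G\<in>graph_family n r \<delta>. ereal (real (tc G)))" for n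
  define \<rho> where "\<rho> M = M * card \<Lambda>" for M
  have card\<Lambda>: "0 < card \<Lambda>"
    using finite_labels labels_nonempty m d by (simp add: \<Lambda>_def card_gt_0_iff)
  have bound: "ereal (real (m * (d + 1))) \<le> X (\<rho> M)"
    if M: "m * (d + 1) \<le> M" "1 / (\<delta> - \<beta>) \<le> real M" for M
  proof -
    obtain \<phi> where \<phi>: "\<forall>v<M * card \<Lambda>. \<phi> v \<in> \<Lambda>" "\<forall>g\<in>\<Lambda>. card {v. v < M * card \<Lambda> \<and> \<phi> v = g} = M"
      using ex_uniform_labelling[of \<Lambda> M] finite_labels by (auto simp: \<Lambda>_def)
    have "0 < M" using M(1) m by (cases M) auto
    then have pos: "0 < \<rho> M" using card\<Lambda> by (simp add: \<rho>_def)
    have "1 \<le> (\<delta> - \<beta>) * real M" using M(2) \<delta> by (simp add: \<beta>_def field_simps)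
    also have "\<dots> \<le> (\<delta> - \<beta>) * real (\<rho> M)"
      using card\<Lambda> \<delta> by (intro mult_left_mono, unfold of_nat_le_iff) (auto simp: \<rho>_def \<beta>_def)
    finally have "1 \<le> (\<delta> - \<beta>) * real (\<rho> M)" .
    moreover have "2 * (r - d) - r = r - 2 * d" using d by simp
    ultimately have fam: "label_graph (\<rho> M) r \<phi> \<in> graph_family (\<rho> M) r \<delta>"
      using m d pos \<phi>
      by (intro label_graph_in_family[where q = "r - d" and m = m and M = M])
         (auto simp: \<rho>_def \<Lambda>_def \<beta>_def)
    have "m * (d + 1) \<le> tc (label_graph (\<rho> M) r \<phi>)"
      using \<phi> M(1) d by (intro label_graph_le_tc) (auto simp: \<rho>_def \<Lambda>_def)
    then have "ereal (real (m * (d + 1))) \<le> ereal (real (tc (label_graph (\<rho> M) r \<phi>)))"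
      by (simp only: ereal_less_eq of_nat_le_iff)
    also have "\<dots> \<le> X (\<rho> M)" unfolding X_def by (rule SUP_upper) (rule fam)
    finally show ?thesis .
  qed
  have "\<forall>\<^sub>F M in sequentially. m * (d + 1) \<le> M \<and> 1 / (\<delta> - \<beta>) \<le> real M"
    using filterlim_real_sequentially
    by (intro eventually_conj eventually_ge_at_top) (simp add: filterlim_at_top)
  then have "\<forall>\<^sub>F M in sequentially. ereal (real (m * (d + 1))) \<le> (X \<circ> \<rho>) M"
    by eventually_elim (use bound in auto)
  then have "ereal (real (m * (d + 1))) \<le> limsup (X \<circ> \<rho>)" by (intro le_Limsup) auto
  also have "\<dots> \<le> limsup X"
    using card\<Lambda> by (intro limsup_subseq_mono) (simp add: strict_mono_def \<rho>_def)
  finally show ?thesis unfolding tc_lim_def X_def .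
qed

section \<open>Choice of parameters and conclusion\<close>

lemma tc_lim_lower_bound:
  fixes \<delta> :: real
  assumes r: "0 < r" and \<delta>: "0 < \<delta>" "\<delta> < 1"
  shows "ereal (1 / 36 * real r * real_of_int \<lceil>real r / ln (1 / \<delta>)\<rceil>) \<le> tc_lim r \<delta>"
proof -
  define L where "L = ln (1 / \<delta>)"
  define d where "d = r div 4"
  \<comment> \<open>With \<open>r - 2 * d \<ge> r / 2\<close>, a value of at most
    \<open>r / (4 * L)\<close> gives \<open>(r - 2 * d) / m \<ge> 2 * L\<close>, twice what is
    needed and hence strict. The maximum covers small \<open>r / L\<close>: for \<open>m = 1\<close>
    the base \<open>1 - 1 / m\<close> is 0 and the exponent is positive.\<close>
  define m where "m = max 1 (nat \<lfloor>real r / (4 * L)\<rfloor>)"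
  have L: "0 < L" "exp (- L) = \<delta>" using \<delta> by (auto simp: L_def ln_div)
  have m: "1 \<le> m" by (simp add: m_def)
  have d: "2 * d < r" "real r \<le> 2 * real (r - 2 * d)" "real r \<le> 4 * real (d + 1)"
    using r by (auto simp: d_def)
  have "(1 - 1 / real m) ^ (r - 2 * d) < \<delta>"
  proof (cases "m = 1")
    case True
    then show ?thesis using d \<delta> by (simp add: power_0_left)
  next
    case False
    then have "real m \<le> real r / (4 * L)" using m unfolding m_def by linarith
    then have "2 * L \<le> real r / (2 * real m)" using L m by (simp add: field_simps)
    also have "\<dots> \<le> real (r - 2 * d) / real m" using d(2) m by (simp add: field_simps)
    finally have *: "2 * L \<le> real (r - 2 * d) * (1 / real m)" by simp
    have "(1 - 1 / real m) ^ (r - 2 * d) \<le> exp (- (1 / real m)) ^ (r - 2 * d)"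
      using m exp_ge_add_one_self[of "- (1 / real m)"] by (intro power_mono) auto
    also have "\<dots> = exp (- (real (r - 2 * d) * (1 / real m)))" by (simp flip: exp_of_nat_mult)
    also have "\<dots> \<le> exp (- (2 * L))" using * by simp
    also have "\<dots> < exp (- L)" using L(1) by simp
    finally show ?thesis using L(2) by simp
  qed
  then have "ereal (real (m * (d + 1))) \<le> tc_lim r \<delta>"
    using m d by (intro tc_lim_ge_labels) auto
  moreover have "1 / 36 * real r * real_of_int \<lceil>real r / L\<rceil> \<le> real (m * (d + 1))"
  proof -
    have "real r / (4 * L) \<le> real m + 1" unfolding m_def by linarith
    then have "real r / L \<le> 4 * real m + 4" using L by (simp add: field_simps)
    \<comment> \<open>Rounding up costs at most 1, and \<open>4 * m + 5 \<le> 9 * m\<close>.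
      Together with \<open>r \<le> 4 * (d + 1)\<close> this gives the constant 36 = 4 * 9.\<close>
    then have "real_of_int \<lceil>real r / L\<rceil> \<le> 9 * real m" using m by linarith
    moreover have "0 \<le> \<lceil>real r / L\<rceil>" using L(1) ceiling_mono[of 0 "real r / L"] by simp
    ultimately have "real r * real_of_int \<lceil>real r / L\<rceil> \<le> (4 * real (d + 1)) * (9 * real m)"
      using d(3) by (intro mult_mono) (simp_all only: of_int_0_le_iff)
    then show ?thesis by (simp add: algebra_simps)
  qed
  ultimately show ?thesis unfolding L_def by (meson ereal_less_eq(3) order_trans)
qed

theorem theorem1p4:
  "\<exists>k K :: real. k > 0 \<and> K > 0 \<and>
     (\<forall>(r::nat) (\<delta>::real). r \<ge> 2 \<longrightarrow> 0 < \<delta> \<longrightarrow> \<delta> < 1 \<longrightarrow>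
        ereal (k * real r * real_of_int \<lceil>real r / ln (1 / \<delta>)\<rceil>) \<le> tc_lim r \<delta> \<and>
        tc_lim r \<delta> \<le> ereal (K * real r *
          real_of_int \<lceil>real r / ln (1 / \<delta>) * ln (1 + real r / ln (1 / \<delta>))\<rceil>) \<and>
        (\<delta> \<ge> 1 / 2 \<longrightarrow> tc_lim r \<delta> \<le> ereal (K * (real r)\<^sup>2 / ln (1 / \<delta>))))"
proof (rule exI[of _ "1 / 36"], rule exI[of _ 8], intro conjI allI impI)
  fix r :: nat and \<delta> :: real
  assume r: "2 \<le> r" and \<delta>: "0 < \<delta>" "\<delta> < 1"
  show "ereal (1 / 36 * real r * real_of_int \<lceil>real r / ln (1 / \<delta>)\<rceil>) \<le> tc_lim r \<delta>"
    using r \<delta> by (intro tc_lim_lower_bound) auto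
  show "tc_lim r \<delta> \<le> ereal (8 * real r *
      real_of_int \<lceil>real r / ln (1 / \<delta>) * ln (1 + real r / ln (1 / \<delta>))\<rceil>)"
    using r \<delta> by (intro tc_lim_le tc_upper_bound) auto
  assume "1 / 2 \<le> \<delta>"
  then have "tc_lim r \<delta> \<le> ereal (2 * (real r)\<^sup>2 / ln (1 / \<delta>))"
    using r \<delta> by (intro tc_lim_le tc_upper_bound_sparse) auto
  \<comment> \<open>The constant 2 is relaxed to 8 so that one \<open>K\<close> serves both upper
    bounds.\<close>
  also have "\<dots> \<le> ereal (8 * (real r)\<^sup>2 / ln (1 / \<delta>))"
    using \<delta> by (simp add: divide_right_mono)
  finally show "tc_lim r \<delta> \<le> ereal (8 * (real r)\<^sup>2 / ln (1 / \<delta>))" .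
qed auto

end
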